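(* Let $\Gamma$ be an infinite, finitely generated group. (1) If $\Gamma$ uniformly has (C), then $\Gamma$ has (A). (2) If $\Gamma$ uniformly has (D) for some $n_0\in\mathbb{N}$ and the complex algebraic set $\mathrm{Hom}(\Gamma,\mathrm{SL}(n_0,\mathbb{C}))$ is irreducible, then $\Gamma$ has (A).
   Context: For a finitely generated group $\Gamma$, $\mathrm{Hom}(\Gamma,\mathrm{SL}(n,\mathbb{C}))$ is the set of homomorphisms, regarded as a complex algebraic set (choosing $r$ generators of $\Gamma$ identifies it with a Zariski closed subset of $\mathrm{SL}(n,\mathbb{C})^r$). $\mathrm{Tr}$ is the matrix trace. Property (A): there exist an integer $n\ge 1$ and $\rho\in\mathrm{Hom}(\Gamma,\mathrm{SL}(n,\mathbb{C}))$ such that $\mathrm{Tr}(\rho(\gamma))\ne\mathrm{Tr}(\rho(\eta))$ for all non-conjugate $\gamma,\eta\in\Gamma$. Property (C): for every finite set $S=\{\gamma_i\}_{i=1}^s$ of (representatives of distinct) conjugacy classes in $\Gamma$, there exist an integer $n_S\ge1$ and $\rho_S\in\mathrm{Hom}(\Gamma,\mathrm{SL}(n_S,\mathbb{C}))$ such that $\mathrm{Tr}(\rho_S(\gamma_i))\ne\mathrm{Tr}(\rho_S(\gamma_j))$ for all $i\neq j$. Property (D): for each non-conjugate pair $\gamma,\eta\in\Gamma$ there exist an integer $n_{\gamma,\eta}\ge1$ and $\rho_{\gamma,\eta}\in\mathrm{Hom}(\Gamma,\mathrm{SL}(n_{\gamma,\eta},\mathbb{C}))$ such that $\mathrm{Tr}(\rho_{\gamma,\eta}(\gamma))\neq\mathrm{Tr}(\rho_{\gamma,\eta}(\eta))$.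 $\Gamma$ uniformly has (C) if the representations $\rho_S$ can be chosen so that $n_S$ is bounded over all finite sets $S$. $\Gamma$ uniformly has (D) for $n_0$ if the representations $\rho_{\gamma,\eta}$ can be chosen so that $n_{\gamma,\eta}\le n_0$ for all non-conjugate pairs $\gamma,\eta$. *)

theory Defs
  imports
    "HOL-Algebra.Generated_Groups"
    "HOL-Library.Poly_Mapping"
    "HOL-Library.FuncSet"
    "Jordan_Normal_Form.Determinant"
begin

section \<open>Groups\<close>

definition generating_tuple :: "('a, 'b) monoid_scheme \<Rightarrow> 'a list \<Rightarrow> bool" where
  "generating_tuple G gs \<longleftrightarrow> set gs \<subseteq> carrier G \<and> generate G (set gs) = carrier G"

definition finitely_generated :: "('a, 'b) monoid_scheme \<Rightarrow> bool" where
  "finitely_generated G \<longleftrightarrow> (\<exists>gs. generating_tuple G gs)"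

definition conjugate_in :: "('a, 'b) monoid_scheme \<Rightarrow> 'a \<Rightarrow> 'a \<Rightarrow> bool" where
  "conjugate_in G x y \<longleftrightarrow> (\<exists>g\<in>carrier G. y = g \<otimes>\<^bsub>G\<^esub> x \<otimes>\<^bsub>G\<^esub> inv\<^bsub>G\<^esub> g)"

section \<open>Representations in the special linear group\<close>

definition SL :: "nat \<Rightarrow> complex mat monoid" where
  "SL n = \<lparr>carrier = {A \<in> carrier_mat n n. det A = 1}, monoid.mult = (*), one = 1\<^sub>m n\<rparr>"

definition Tr :: "complex mat \<Rightarrow> complex" where
  "Tr A = (\<Sum>i<dim_row A. A $$ (i, i))"

definition property_A :: "('a, 'b) monoid_scheme \<Rightarrow> bool" where
  "property_A G \<longleftrightarrow>
     (\<exists>n\<ge>1. \<exists>\<rho>\<in>hom G (SL n).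
        \<forall>x\<in>carrier G. \<forall>y\<in>carrier G. \<not> conjugate_in G x y \<longrightarrow> Tr (\<rho> x) \<noteq> Tr (\<rho> y))"

text \<open>A finite family of representatives of distinct conjugacy classes is encoded as a finite set
  whose distinct elements are pairwise non-conjugate.\<close>

definition class_representatives :: "('a, 'b) monoid_scheme \<Rightarrow> 'a set \<Rightarrow> bool" where
  "class_representatives G S \<longleftrightarrow> finite S \<and> S \<subseteq> carrier G \<and>
     (\<forall>x\<in>S. \<forall>y\<in>S. x \<noteq> y \<longrightarrow> \<not> conjugate_in G x y)"

definition uniformly_C :: "('a, 'b) monoid_scheme \<Rightarrow> bool" where
  "uniformly_C G \<longleftrightarrow>
     (\<exists>N. \<forall>S. class_representatives G S \<longrightarrow>
        (\<exists>n. 1 \<le> n \<and> n \<le> N \<and>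
          (\<exists>\<rho>\<in>hom G (SL n). \<forall>x\<in>S. \<forall>y\<in>S. x \<noteq> y \<longrightarrow> Tr (\<rho> x) \<noteq> Tr (\<rho> y))))"

definition uniformly_D :: "('a, 'b) monoid_scheme \<Rightarrow> nat \<Rightarrow> bool" where
  "uniformly_D G n0 \<longleftrightarrow>
     (\<forall>x\<in>carrier G. \<forall>y\<in>carrier G. \<not> conjugate_in G x y \<longrightarrow>
        (\<exists>n. 1 \<le> n \<and> n \<le> n0 \<and> (\<exists>\<rho>\<in>hom G (SL n). Tr (\<rho> x) \<noteq> Tr (\<rho> y))))"

section \<open>The Zariski topology on a complex affine space\<close>

text \<open>Polynomials in indeterminates of type \<open>'v\<close> are finitely supported maps from monomials
  (finitely supported exponent vectors) to coefficients. The affine space with finite coordinate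
  set \<open>I\<close> is \<open>I \<rightarrow>\<^sub>E UNIV\<close>.\<close>

type_synonym 'v mpoly = "('v \<Rightarrow>\<^sub>0 nat) \<Rightarrow>\<^sub>0 complex"

definition mpoly_eval :: "'v mpoly \<Rightarrow> ('v \<Rightarrow> complex) \<Rightarrow> complex" where
  "mpoly_eval p x =
     (\<Sum>m\<in>Poly_Mapping.keys p.
        Poly_Mapping.lookup p m * (\<Prod>v\<in>Poly_Mapping.keys m. x v ^ Poly_Mapping.lookup m v))"

definition mpolys_in :: "'v set \<Rightarrow> 'v mpoly set" where
  "mpolys_in I = {p. \<forall>m\<in>Poly_Mapping.keys p. Poly_Mapping.keys m \<subseteq> I}"

definition zariski_closed :: "'v set \<Rightarrow> ('v \<Rightarrow> complex) set \<Rightarrow> bool" where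
  "zariski_closed I Z \<longleftrightarrow>
     (\<exists>P\<subseteq>mpolys_in I. Z = {x \<in> I \<rightarrow>\<^sub>E UNIV. \<forall>p\<in>P. mpoly_eval p x = 0})"

text \<open>Irreducibility of a subset in the subspace topology: it is non-empty and not the union of
  two proper relatively closed subsets.\<close>

definition zariski_irreducible :: "'v set \<Rightarrow> ('v \<Rightarrow> complex) set \<Rightarrow> bool" where
  "zariski_irreducible I V \<longleftrightarrow> V \<noteq> {} \<and>
     (\<forall>Z1 Z2. zariski_closed I Z1 \<longrightarrow> zariski_closed I Z2 \<longrightarrow> V \<subseteq> Z1 \<union> Z2 \<longrightarrow>
        V \<subseteq> Z1 \<or> V \<subseteq> Z2)"

section \<open>The representation variety\<close>

text \<open>A homomorphism is recorded by the matrix entries of the images of the generators: coordinate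
  \<open>(k, i, j)\<close> is entry \<open>(i, j)\<close> of the image of the \<open>k\<close>-th generator. For a generating
  tuple this identifies the homomorphisms with a subset of \<open>SL(n)\<close> to the power \<open>length gs\<close>,
  inside affine space of dimension \<open>length gs * n * n\<close>.\<close>

definition hom_coords :: "'a list \<Rightarrow> nat \<Rightarrow> (nat \<times> nat \<times> nat) set" where
  "hom_coords gs n = {..<length gs} \<times> {..<n} \<times> {..<n}"

definition hom_point ::
  "'a list \<Rightarrow> nat \<Rightarrow> ('a \<Rightarrow> complex mat) \<Rightarrow> nat \<times> nat \<times> nat \<Rightarrow> complex" where
  "hom_point gs n \<rho> = (\<lambda>(k, i, j)\<in>hom_coords gs n. \<rho> (gs ! k) $$ (i, j))"

definition hom_variety ::
  "('a, 'b) monoid_scheme \<Rightarrow> 'a list \<Rightarrow> nat \<Rightarrow> (nat \<times> nat \<times> nat \<Rightarrow> complex) set" where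
  "hom_variety G gs n = hom_point gs n ` hom G (SL n)"

end

theory Submission
  imports Defs
    "HOL-Analysis.Continuum_Not_Denumerable"
    "HOL-Computational_Algebra.Fundamental_Theorem_Algebra"
    "Jordan_Normal_Form.Char_Poly"
begin

text \<open>
  Both parts rest on one compactness principle, \<open>common_zero_of_finitely_satisfiable\<close>: a system of
  complex polynomial equations in countably many unknowns has a solution as soon as each of its
  finite subsystems has one. It is Hilbert's Nullstellensatz in countably many variables, and over
  \<open>\<complex>\<close> it has a short proof. The polynomials that vanish wherever some finite subsystem holds form
  a proper ideal; extend it to a maximal ideal \<open>M\<close>. The quotient by \<open>M\<close> is a field of countable
  dimension over \<open>\<complex>\<close>. An element \<open>x\<close> of it outside \<open>\<complex>\<close> would make all the \<open>1 / (x - a)\<close> available;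
  there are uncountably many of them, so they are linearly dependent, and clearing denominators
  shows that \<open>x\<close> is algebraic over \<open>\<complex>\<close>, hence in \<open>\<complex>\<close> after all. So every unknown is congruent
  modulo \<open>M\<close> to a complex number, and these numbers solve the system.

  A finitely generated group \<open>G\<close> is countable. Take the matrix entries of \<open>\<rho> g\<close>, for all \<open>g\<close>, as
  unknowns: that \<open>\<rho>\<close> is a homomorphism into \<open>SL n\<close> is a system of polynomial equations, and that
  the traces of \<open>\<rho> g\<close> and \<open>\<rho> h\<close> differ is one more equation in one more unknown, the inverse of their
  difference. By compactness, a single representation of dimension \<open>n\<close> separates all pairs of
  non-conjugate elements if any finitely many such pairs are separated by some representation of
  that same dimension \<open>n\<close> (\<open>property_A_if_finitely_separated\<close>). In geometric terms this is the fact
  that countably many closed subsets cover a complex variety only if finitely many of them do.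

  The finite hypothesis is checked in each part. A representation is brought up to a common
  dimension by adding a trivial summand, which shifts all its traces by the same number. For
  uniform (C), replace the members of finitely many pairs by representatives of their conjugacy
  classes. For uniform (D), each pair cuts out a proper Zariski closed subset of the representation
  variety, because traces are polynomials in the entries of the generators, and finitely many
  proper closed subsets do not cover an irreducible set.
\<close>

section \<open>Maximal ideals of complex algebras of countable dimension\<close>

definition ring_ideal :: "'r::comm_ring_1 set \<Rightarrow> bool" where
  "ring_ideal J \<longleftrightarrow> 0 \<in> J \<and> (\<forall>x\<in>J. \<forall>y\<in>J. x + y \<in> J) \<and> (\<forall>r. \<forall>x\<in>J. r * x \<in> J)"

lemma ring_idealI:
  assumes "0 \<in> J" "\<And>x y. x \<in> J \<Longrightarrow> y \<in> J \<Longrightarrow> x + y \<in> J" "\<And>r x. x \<in> J \<Longrightarrow> r * x \<in> J"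
  shows "ring_ideal J"
  using assms by (auto simp: ring_ideal_def)

lemma
  assumes "ring_ideal J"
  shows ring_ideal_zero: "0 \<in> J"
    and ring_ideal_add: "x \<in> J \<Longrightarrow> y \<in> J \<Longrightarrow> x + y \<in> J"
    and ring_ideal_mult: "x \<in> J \<Longrightarrow> r * x \<in> J"
  using assms by (auto simp: ring_ideal_def)

lemma ring_ideal_uminus: "ring_ideal J \<Longrightarrow> x \<in> J \<Longrightarrow> - x \<in> J"
  using ring_ideal_mult[of J x "-1"] by simp

lemma ring_ideal_diff: "ring_ideal J \<Longrightarrow> x \<in> J \<Longrightarrow> y \<in> J \<Longrightarrow> x - y \<in> J"
  using ring_ideal_add[of J x "- y"] ring_ideal_uminus[of J y] by simp

lemma ring_ideal_sum: "ring_ideal J \<Longrightarrow> (\<And>i. i \<in> A \<Longrightarrow> f i \<in> J) \<Longrightarrow> sum f A \<in> J"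
  by (induction A rule: infinite_finite_induct) (auto simp: ring_ideal_zero ring_ideal_add)

text \<open>Zorn's lemma. The last conclusion is the form in which maximality is used: the quotient by \<open>M\<close>
  is a field.\<close>

lemma exists_maximal_ideal:
  fixes J :: "'r::comm_ring_1 set"
  assumes J: "ring_ideal J" and J1: "1 \<notin> J"
  obtains M where "J \<subseteq> M" "ring_ideal M" "1 \<notin> M"
    "\<And>x. x \<notin> M \<Longrightarrow> \<exists>q. q * x - 1 \<in> M"
proof -
  let ?A = "{M. J \<subseteq> M \<and> ring_ideal M \<and> 1 \<notin> M}"
  have "\<exists>M\<in>?A. \<forall>X\<in>?A. M \<subseteq> X \<longrightarrow> X = M"
  proof (rule subset_Zorn_nonempty)
    show "?A \<noteq> {}" using J J1 by auto
  next
    fix C assume ne: "C \<noteq> {}" and ch: "subset.chain ?A C"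
    have CA: "\<And>M. M \<in> C \<Longrightarrow> M \<in> ?A" using ch by (auto simp: subset_chain_def)
    have "ring_ideal (\<Union>C)"
    proof (rule ring_idealI)
      show "0 \<in> \<Union>C" using ne CA ring_ideal_zero by fastforce
    next
      fix x y assume "x \<in> \<Union>C" "y \<in> \<Union>C"
      then obtain X Y where X: "X \<in> C" "x \<in> X" and Y: "Y \<in> C" "y \<in> Y" by auto
      have "X \<subseteq> Y \<or> Y \<subseteq> X" using ch X Y by (auto simp: subset_chain_def)
      then obtain Z where "Z \<in> C" "x \<in> Z" "y \<in> Z" using X Y by blast
      then show "x + y \<in> \<Union>C" using CA ring_ideal_add by blast
    next
      fix c x assume "x \<in> \<Union>C"
      then show "c * x \<in> \<Union>C" using CA ring_ideal_mult by blast
    qed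
    then show "\<Union>C \<in> ?A" using ne CA by blast
  qed
  then obtain M where M: "J \<subseteq> M" "ring_ideal M" "1 \<notin> M"
    and mx: "\<And>X. X \<in> ?A \<Longrightarrow> M \<subseteq> X \<Longrightarrow> X = M" by auto
  have "\<exists>q. q * x - 1 \<in> M" if x: "x \<notin> M" for x
  proof (rule ccontr)
    assume no: "\<nexists>q. q * x - 1 \<in> M"
    let ?X = "{m + q * x | m q. m \<in> M}"
    have sub: "ring_ideal ?X"
    proof (rule ring_idealI)
      have "0 = 0 + 0 * x" by simp
      then show "0 \<in> ?X" using ring_ideal_zero[OF M(2)] by blast
    next
      fix a b assume "a \<in> ?X" "b \<in> ?X"
      then obtain m q m' q' where "a = m + q * x" "b = m' + q' * x" "m \<in> M" "m' \<in> M" by auto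
      moreover from this have "m + m' \<in> M" using ring_ideal_add[OF M(2)] by blast
      moreover have "a + b = (m + m') + (q + q') * x"
        using calculation by (simp add: algebra_simps)
      ultimately show "a + b \<in> ?X" by blast
    next
      fix c a assume "a \<in> ?X"
      then obtain m q where "a = m + q * x" "m \<in> M" by auto
      moreover from this have "c * m \<in> M" using ring_ideal_mult[OF M(2)] by blast
      moreover have "c * a = c * m + (c * q) * x"
        using calculation by (simp add: algebra_simps)
      ultimately show "c * a \<in> ?X" by blast
    qed
    have MX: "M \<subseteq> ?X"
    proof
      fix m assume "m \<in> M"
      moreover have "m = m + 0 * x" by simp
      ultimately show "m \<in> ?X" by blast
    qed
    have "1 \<notin> ?X"
    proof
      assume "1 \<in> ?X"
      then obtain m q where mq: "1 = m + q * x" "m \<in> M" by auto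
      have "q * x - 1 = (-1) * m" using mq(1) by (simp add: algebra_simps)
      then have "q * x - 1 \<in> M"
        using ring_ideal_mult[OF M(2) mq(2), of "-1"] by simp
      with no show False by blast
    qed
    with sub MX M(1) have "?X = M" by (intro mx) auto
    moreover have "x \<in> ?X"
    proof -
      have "x = 0 + 1 * x" by simp
      then show ?thesis using ring_ideal_zero[OF M(2)] by blast
    qed
    ultimately show False using x by simp
  qed
  with M show ?thesis by (rule that)
qed

text \<open>The complex numbers have no proper algebraic extension: split a root off \<open>h\<close> and, in the field
  of residues modulo \<open>M\<close>, cancel whichever of the two factors is not zero.\<close>

lemma maximal_ideal_algebraic_residue_scalar:
  fixes c :: "complex \<Rightarrow> 'r::comm_ring_1"
  assumes c: "comm_ring_hom c"
    and M: "ring_ideal M" "1 \<notin> M" "\<And>x. x \<notin> M \<Longrightarrow> \<exists>q. q * x - 1 \<in> M"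
    and h: "h \<noteq> 0" "poly (map_poly c h) x \<in> M"
  shows "\<exists>a. x - c a \<in> M"
  using h
proof (induction "degree h" arbitrary: h)
  interpret c: comm_ring_hom c by fact
  case 0
  then obtain u where u: "h = [:u:]" "u \<noteq> 0" by (metis degree_eq_zeroE pCons_0_0)
  then have "c u \<in> M" using 0 by (simp add: c.map_poly_pCons_hom)
  then have "c (inverse u) * c u \<in> M" using ring_ideal_mult[OF M(1)] by blast
  then have "c (inverse u * u) \<in> M" by (simp add: c.hom_mult)
  then show ?case using u M(2) by simp
next
  interpret c: comm_ring_hom c by fact
  interpret mp: map_poly_comm_ring_hom c ..
  case (Suc d)
  then have "\<not> constant (poly h)" by (simp add: constant_degree)
  then obtain a where a: "poly h a = 0" using fundamental_theorem_of_algebra by blast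
  then obtain g where g: "h = [:- a, 1:] * g" by (auto simp: poly_eq_0_iff_dvd elim: dvdE)
  have g0: "g \<noteq> 0" using g Suc by auto
  have dg: "degree h = Suc (degree g)" unfolding g using g0 by (subst degree_mult_eq) auto
  have eq: "poly (map_poly c h) x = (x - c a) * poly (map_poly c g) x"
  proof -
    have "map_poly c [:- a, 1:] = [:- c a, 1:]"
      by (simp add: c.map_poly_pCons_hom c.hom_uminus)
    then show ?thesis unfolding g mp.hom_mult poly_mult by simp
  qed
  show ?case
  proof (cases "poly (map_poly c g) x \<in> M")
    case True
    then show ?thesis using Suc dg g0 by auto
  next
    case False
    then obtain q where q: "q * poly (map_poly c g) x - 1 \<in> M" using M(3) by blast
    have "q * poly (map_poly c h) x - (x - c a) * (q * poly (map_poly c g) x - 1) \<in> M"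
      using q Suc(4) ring_ideal_mult[OF M(1)] ring_ideal_diff[OF M(1)] by blast
    also have "q * poly (map_poly c h) x - (x - c a) * (q * poly (map_poly c g) x - 1) = x - c a"
      unfolding eq by (simp add: algebra_simps)
    finally show ?thesis by blast
  qed
qed

text \<open>If no \<open>x - c a\<close> lies in \<open>M\<close>, each has an inverse \<open>q a\<close> modulo \<open>M\<close>. Only countably many finite
  subsets of \<open>B\<close> compete for uncountably many scalars \<open>a\<close>, so one of them spans infinitely many
  of the \<open>q a\<close>, and these satisfy a linear relation. Multiplied by the product of the \<open>x - c a\<close>
  involved, the relation becomes a polynomial equation for \<open>x\<close> modulo \<open>M\<close>.\<close>

lemma maximal_ideal_residue_scalar:
  fixes c :: "complex \<Rightarrow> 'r::comm_ring_1"
  assumes c: "comm_ring_hom c"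
    and B: "countable B" "Modules.module.span (\<lambda>a r. c a * r) B = UNIV"
    and M: "ring_ideal M" "1 \<notin> M" "\<And>x. x \<notin> M \<Longrightarrow> \<exists>q. q * x - 1 \<in> M"
  shows "\<exists>a. x - c a \<in> M"
proof (rule ccontr)
  interpret c: comm_ring_hom c by fact
  interpret mp: map_poly_comm_ring_hom c ..
  assume no: "\<nexists>a. x - c a \<in> M"
  then have "\<forall>a. \<exists>q. q * (x - c a) - 1 \<in> M" using M(3) by blast
  then obtain q where q: "\<And>a. q a * (x - c a) - 1 \<in> M" by metis
  \<comment> \<open>Equal inverses of \<open>x - c a\<close> and \<open>x - c b\<close> would put a multiple of the unit \<open>c (b - a)\<close> into \<open>M\<close>.\<close>
  have inj: "inj q"
  proof (rule injI, rule ccontr)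
    fix a b assume ab: "q a = q b" "a \<noteq> b"
    have "(q a * (x - c a) - 1) - (q b * (x - c b) - 1) \<in> M"
      using q ring_ideal_diff[OF M(1)] by blast
    also have "(q a * (x - c a) - 1) - (q b * (x - c b) - 1) = q a * c (b - a)"
      using ab by (simp add: c.hom_minus algebra_simps)
    finally have "(c (inverse (b - a)) * (x - c a)) * (q a * c (b - a)) \<in> M"
      using ring_ideal_mult[OF M(1)] by blast
    also have "(c (inverse (b - a)) * (x - c a)) * (q a * c (b - a))
      = c (inverse (b - a) * (b - a)) * (q a * (x - c a))"
      by (simp only: c.hom_mult ac_simps)
    also have "\<dots> = q a * (x - c a)" using ab by simp
    finally have "q a * (x - c a) - (q a * (x - c a) - 1) \<in> M"
      using q ring_ideal_diff[OF M(1)] by blast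
    then show False using M(2) by simp
  qed
  interpret vs: vector_space "\<lambda>a r. c a * r"
    by standard (simp_all add: algebra_simps c.hom_add c.hom_mult)
  obtain F where F: "finite F" "infinite {a. q a \<in> vs.span F}"
  proof (rule ccontr)
    assume *: "\<not> thesis"
    have fin: "\<And>F. finite F \<Longrightarrow> countable {a. q a \<in> vs.span F}"
      using * that countable_finite by blast
    have "UNIV \<subseteq> (\<Union>F\<in>{F. F \<subseteq> B \<and> finite F}. {a. q a \<in> vs.span F})"
    proof
      fix a
      have "q a \<in> vs.span B" using B by simp
      then obtain t u where "finite t" "t \<subseteq> B" "q a = (\<Sum>v\<in>t. c (u v) * v)"
        unfolding vs.span_explicit by blast
      moreover have "(\<Sum>v\<in>t. c (u v) * v) \<in> vs.span t"
        by (intro vs.span_sum vs.span_scale vs.span_base)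
      ultimately have "t \<subseteq> B \<and> finite t" "q a \<in> vs.span t" by simp_all
      then show "a \<in> (\<Union>F\<in>{F. F \<subseteq> B \<and> finite F}. {a. q a \<in> vs.span F})" by blast
    qed
    moreover have "countable (\<Union>F\<in>{F. F \<subseteq> B \<and> finite F}. {a. q a \<in> vs.span F})"
      using fin countable_Collect_finite_subset[OF B(1)]
      by (intro countable_UN) (auto simp: conj_commute)
    ultimately show False using uncountable_UNIV_complex countable_subset by blast
  qed
  define A where "A = {a. q a \<in> vs.span F}"
  have "infinite (q ` A)" using F inj by (simp add: A_def finite_image_iff inj_on_subset)
  moreover have "q ` A \<subseteq> vs.span F" by (auto simp: A_def)
  ultimately have "vs.dependent (q ` A)" using vs.independent_span_bound[OF F(1)] by blast
  then obtain S u v where S: "finite S" "S \<subseteq> q ` A" "v \<in> S" "u v \<noteq> 0"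
    "(\<Sum>v\<in>S. c (u v) * v) = 0" unfolding vs.dependent_explicit by blast
  define T where "T = q -` S"
  have T: "finite T" unfolding T_def using inj S(1) by (simp add: finite_vimageI)
  have ST: "S = q ` T" using S(2) by (auto simp: T_def)
  define w where "w a = u (q a)" for a
  have sum0: "(\<Sum>a\<in>T. c (w a) * q a) = 0"
    using S(5) inj unfolding ST w_def by (subst (asm) sum.reindex) (auto intro: inj_on_subset)
  obtain b where b: "b \<in> T" "w b \<noteq> 0" using S(3,4) ST w_def by auto
  \<comment> \<open>The relation after clearing denominators. At \<open>b\<close> only the summand of index \<open>b\<close> survives, so
    \<open>h\<close> is not zero.\<close>
  define h where "h = (\<Sum>a\<in>T. smult (w a) (\<Prod>l\<in>T - {a}. [:- l, 1:]))"
  have "poly h b = (\<Sum>a\<in>T. if a = b then w b * (\<Prod>l\<in>T - {b}. b - l) else 0)"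
    unfolding h_def poly_sum
  proof (rule sum.cong[OF refl])
    fix a assume "a \<in> T"
    show "poly (smult (w a) (\<Prod>l\<in>T - {a}. [:- l, 1:])) b
      = (if a = b then w b * (\<Prod>l\<in>T - {b}. b - l) else 0)"
      using T b(1) by (auto simp: poly_prod prod_zero_iff)
  qed
  also have "\<dots> \<noteq> 0" using T b by (auto simp: sum.delta)
  finally have h0: "h \<noteq> 0" by auto
  have hx: "poly (map_poly c h) x = (\<Sum>a\<in>T. c (w a) * (\<Prod>l\<in>T - {a}. x - c l))"
    unfolding h_def
    by (simp add: mp.hom_sum poly_sum c.map_poly_hom_smult mp.hom_prod poly_prod
        c.map_poly_pCons_hom c.hom_uminus)
  have "0 = (\<Prod>l\<in>T. x - c l) * (\<Sum>a\<in>T. c (w a) * q a)" using sum0 by simp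
  also have "\<dots> = (\<Sum>a\<in>T. c (w a) * (\<Prod>l\<in>T - {a}. x - c l) * (q a * (x - c a)))"
    unfolding sum_distrib_left
  proof (rule sum.cong[OF refl])
    fix a assume a: "a \<in> T"
    show "(\<Prod>l\<in>T. x - c l) * (c (w a) * q a)
      = c (w a) * (\<Prod>l\<in>T - {a}. x - c l) * (q a * (x - c a))"
      by (subst prod.remove[OF T a]) (simp only: ac_simps)
  qed
  finally have "poly (map_poly c h) x
    = - (\<Sum>a\<in>T. c (w a) * (\<Prod>l\<in>T - {a}. x - c l) * (q a * (x - c a) - 1))"
    unfolding hx by (simp add: right_diff_distrib sum_subtractf)
  also have "\<dots> \<in> M"
    by (intro ring_ideal_uminus[OF M(1)] ring_ideal_sum[OF M(1)]
        ring_ideal_mult[OF M(1)] q)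
  finally show False
    using maximal_ideal_algebraic_residue_scalar[OF c M h0] no by blast
qed

section \<open>Evaluation of polynomials\<close>

abbreviation mconst :: "complex \<Rightarrow> 'v mpoly" where
  "mconst a \<equiv> Poly_Mapping.single 0 a"

definition mvar :: "'v \<Rightarrow> 'v mpoly" where
  "mvar v = Poly_Mapping.single (Poly_Mapping.single v 1) 1"

definition monomial_eval :: "('v \<Rightarrow>\<^sub>0 nat) \<Rightarrow> ('v \<Rightarrow> complex) \<Rightarrow> complex" where
  "monomial_eval m x = (\<Prod>v\<in>Poly_Mapping.keys m. x v ^ Poly_Mapping.lookup m v)"

lemma monomial_eval_superset:
  assumes "finite A" "Poly_Mapping.keys m \<subseteq> A"
  shows "monomial_eval m x = (\<Prod>v\<in>A. x v ^ Poly_Mapping.lookup m v)"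
  unfolding monomial_eval_def using assms
  by (intro prod.mono_neutral_left) (auto simp: in_keys_iff)

lemma monomial_eval_add: "monomial_eval (m + n) x = monomial_eval m x * monomial_eval n x"
proof -
  let ?A = "Poly_Mapping.keys m \<union> Poly_Mapping.keys n"
  have "monomial_eval (m + n) x = (\<Prod>v\<in>?A. x v ^ Poly_Mapping.lookup (m + n) v)"
    by (rule monomial_eval_superset) (use keys_add[of m n] in auto)
  also have "\<dots> = (\<Prod>v\<in>?A. x v ^ Poly_Mapping.lookup m v) * (\<Prod>v\<in>?A. x v ^ Poly_Mapping.lookup n v)"
    by (simp add: lookup_add power_add prod.distrib)
  also have "\<dots> = monomial_eval m x * monomial_eval n x"
    by (simp add: monomial_eval_superset[of ?A])
  finally show ?thesis .
qed

lemma mpoly_eval_superset: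
  assumes "finite A" "Poly_Mapping.keys p \<subseteq> A"
  shows "mpoly_eval p x = (\<Sum>m\<in>A. Poly_Mapping.lookup p m * monomial_eval m x)"
  unfolding mpoly_eval_def monomial_eval_def[symmetric] using assms
  by (intro sum.mono_neutral_left) (auto simp: in_keys_iff)

lemma mpoly_eval_single:
  "mpoly_eval (Poly_Mapping.single m a) x = a * monomial_eval m x"
  by (subst mpoly_eval_superset[of "{m}"]) auto

lemma mpoly_eval_const [simp]: "mpoly_eval (mconst a) x = a"
  by (simp add: mpoly_eval_single monomial_eval_def)

lemma mpoly_eval_var [simp]: "mpoly_eval (mvar v) x = x v"
  by (simp add: mvar_def mpoly_eval_single monomial_eval_def)

lemma mpoly_eval_zero: "mpoly_eval 0 x = 0"
  by (simp add: mpoly_eval_def)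

lemma mpoly_eval_add: "mpoly_eval (p + q) x = mpoly_eval p x + mpoly_eval q x"
proof -
  let ?A = "Poly_Mapping.keys p \<union> Poly_Mapping.keys q"
  have "mpoly_eval (p + q) x = (\<Sum>m\<in>?A. Poly_Mapping.lookup (p + q) m * monomial_eval m x)"
    by (rule mpoly_eval_superset) (use keys_add[of p q] in auto)
  also have "\<dots> = (\<Sum>m\<in>?A. Poly_Mapping.lookup p m * monomial_eval m x)
      + (\<Sum>m\<in>?A. Poly_Mapping.lookup q m * monomial_eval m x)"
    by (simp add: lookup_add distrib_right sum.distrib)
  also have "\<dots> = mpoly_eval p x + mpoly_eval q x"
    by (simp add: mpoly_eval_superset[of ?A])
  finally show ?thesis .
qed

lemma mpoly_eval_sum: "mpoly_eval (sum f A) x = (\<Sum>a\<in>A. mpoly_eval (f a) x)"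
  by (induction A rule: infinite_finite_induct) (simp_all add: mpoly_eval_zero mpoly_eval_add)

lemma poly_mapping_sum_single:
  "p = (\<Sum>m\<in>Poly_Mapping.keys p. Poly_Mapping.single m (Poly_Mapping.lookup p m))"
proof (rule poly_mapping_eqI)
  fix k
  have "Poly_Mapping.lookup (\<Sum>m\<in>Poly_Mapping.keys p. Poly_Mapping.single m (Poly_Mapping.lookup p m)) k
    = (\<Sum>m\<in>Poly_Mapping.keys p. if m = k then Poly_Mapping.lookup p k else 0)"
    unfolding lookup_sum by (intro sum.cong) (auto simp: lookup_single when_def)
  then show "Poly_Mapping.lookup p k
    = Poly_Mapping.lookup (\<Sum>m\<in>Poly_Mapping.keys p. Poly_Mapping.single m (Poly_Mapping.lookup p m)) k"
    by (simp add: sum.delta in_keys_iff)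
qed

lemma mpoly_eval_mult: "mpoly_eval (p * q) x = mpoly_eval p x * mpoly_eval q x"
proof -
  let ?s = "\<lambda>p m. Poly_Mapping.single m (Poly_Mapping.lookup p m)"
  have "mpoly_eval (p * q) x
    = mpoly_eval ((\<Sum>m\<in>Poly_Mapping.keys p. ?s p m) * (\<Sum>n\<in>Poly_Mapping.keys q. ?s q n)) x"
    using poly_mapping_sum_single[of p] poly_mapping_sum_single[of q] by simp
  also have "\<dots> = (\<Sum>m\<in>Poly_Mapping.keys p. mpoly_eval (?s p m) x)
      * (\<Sum>n\<in>Poly_Mapping.keys q. mpoly_eval (?s q n) x)"
    unfolding sum_product mpoly_eval_sum mult_single
    by (simp add: mpoly_eval_single monomial_eval_add mult_ac)
  also have "\<dots> = mpoly_eval p x * mpoly_eval q x"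
    unfolding mpoly_eval_sum[symmetric] by (simp flip: poly_mapping_sum_single)
  finally show ?thesis .
qed

lemma comm_ring_hom_mpoly_eval: "comm_ring_hom (\<lambda>p. mpoly_eval p x)"
proof
  show "mpoly_eval 1 x = 1" using mpoly_eval_const[of 1 x] by (simp add: single_one)
qed (simp_all add: mpoly_eval_zero mpoly_eval_add mpoly_eval_mult)

lemma comm_ring_hom_mconst: "comm_ring_hom mconst"
  by standard (simp_all add: single_add mult_single)

lemma single_sum_eq_prod:
  "Poly_Mapping.single (sum f A) (1::complex) = (\<Prod>a\<in>A. Poly_Mapping.single (f a) 1)"
  by (induction A rule: infinite_finite_induct) (simp_all flip: mult_single[of _ "1::complex" _ 1, simplified])

lemma mvar_power: "mvar v ^ k = Poly_Mapping.single (Poly_Mapping.single v k) 1"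
  by (induction k) (simp_all add: mvar_def mult_single flip: single_add)

lemma single_eq_const_times_vars:
  "Poly_Mapping.single m a = mconst a * (\<Prod>v\<in>Poly_Mapping.keys m. mvar v ^ Poly_Mapping.lookup m v)"
proof -
  have "Poly_Mapping.single m 1 = (\<Prod>v\<in>Poly_Mapping.keys m. mvar v ^ Poly_Mapping.lookup m v)"
    by (subst poly_mapping_sum_single[of m]) (simp only: single_sum_eq_prod mvar_power)
  moreover have "Poly_Mapping.single m a = mconst a * Poly_Mapping.single m 1"
    by (simp add: mult_single)
  ultimately show ?thesis by simp
qed

text \<open>Polynomials are generated as a ring by the constants and the indeterminates, so a property
  closed under sums and products need be checked only there.\<close>

lemma mpoly_induct [case_names const var add mult]:
  fixes p :: "'v mpoly"
  assumes const: "\<And>a. P (mconst a)" and var: "\<And>v. P (mvar v)"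
    and add: "\<And>p q. P p \<Longrightarrow> P q \<Longrightarrow> P (p + q)"
    and mult: "\<And>p q. P p \<Longrightarrow> P q \<Longrightarrow> P (p * q)"
  shows "P p"
proof -
  have zero: "P 0" using const[of 0] by simp
  have one: "P 1" using const[of 1] by (simp add: single_one)
  have power: "P (q ^ k)" if "P q" for q k
    using that by (induction k) (auto intro: one mult)
  have prod: "P (prod f A)" if "\<And>a. P (f a)" for f :: "'v \<Rightarrow> 'v mpoly" and A
    using that by (induction A rule: infinite_finite_induct) (auto intro: one mult)
  have sum: "P (sum f A)" if "\<And>a. P (f a)" for f :: "('v \<Rightarrow>\<^sub>0 nat) \<Rightarrow> 'v mpoly" and A
    using that by (induction A rule: infinite_finite_induct) (auto intro: zero add)
  have "P (\<Sum>m\<in>Poly_Mapping.keys p. Poly_Mapping.single m (Poly_Mapping.lookup p m))"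
    by (intro sum) (subst single_eq_const_times_vars, intro mult const prod power var)
  then show ?thesis by (simp flip: poly_mapping_sum_single)
qed

section \<open>Polynomials in a given set of indeterminates\<close>

lemma mvar_in: "v \<in> I \<Longrightarrow> mvar v \<in> mpolys_in I"
  by (simp add: mvar_def mpolys_in_def)

lemma mpolys_in_add: "p \<in> mpolys_in I \<Longrightarrow> q \<in> mpolys_in I \<Longrightarrow> p + q \<in> mpolys_in I"
  unfolding mpolys_in_def using keys_add[of p q] by blast

lemma mpolys_in_mult:
  assumes "p \<in> mpolys_in I" "q \<in> mpolys_in I" shows "p * q \<in> mpolys_in I"
  unfolding mpolys_in_def
proof (clarify)
  fix m v assume m: "m \<in> Poly_Mapping.keys (p * q)" "v \<in> Poly_Mapping.keys m"
  then obtain a b where "m = a + b" "a \<in> Poly_Mapping.keys p" "b \<in> Poly_Mapping.keys q"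
    using keys_mult[of p q] by blast
  then show "v \<in> I" using m(2) keys_add[of a b] assms by (auto simp: mpolys_in_def)
qed

lemma mpolys_in_zero: "0 \<in> mpolys_in I"
  by (simp add: mpolys_in_def)

lemma mpolys_in_one: "1 \<in> mpolys_in I"
  by (simp add: mpolys_in_def)

lemma mpolys_in_uminus: "p \<in> mpolys_in I \<Longrightarrow> - p \<in> mpolys_in I"
  by (simp add: mpolys_in_def)

lemma mpolys_in_diff: "p \<in> mpolys_in I \<Longrightarrow> q \<in> mpolys_in I \<Longrightarrow> p - q \<in> mpolys_in I"
  using mpolys_in_add[of p I "- q"] mpolys_in_uminus[of q I] by simp

lemma mpolys_in_sum: "(\<And>a. a \<in> A \<Longrightarrow> f a \<in> mpolys_in I) \<Longrightarrow> sum f A \<in> mpolys_in I"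
  by (induction A rule: infinite_finite_induct) (auto intro: mpolys_in_zero mpolys_in_add)

lemma mpolys_in_prod: "(\<And>a. a \<in> A \<Longrightarrow> f a \<in> mpolys_in I) \<Longrightarrow> prod f A \<in> mpolys_in I"
  by (induction A rule: infinite_finite_induct) (auto intro: mpolys_in_one mpolys_in_mult)

lemma mpolys_in_det:
  assumes A: "A \<in> carrier_mat n n" and en: "\<And>i j. i < n \<Longrightarrow> j < n \<Longrightarrow> A $$ (i, j) \<in> mpolys_in I"
  shows "det A \<in> mpolys_in I"
  unfolding det_def'[OF A]
proof (intro mpolys_in_sum mpolys_in_mult mpolys_in_prod)
  fix p assume "p \<in> {p. p permutes {0..<n}}"
  then show "A $$ (i, p i) \<in> mpolys_in I" if "i \<in> {0..<n}" for i
    using that en permutes_in_image[of p "{0..<n}" i] by auto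
  show "signof p \<in> mpolys_in I"
    using mpolys_in_one mpolys_in_uminus[OF mpolys_in_one] by (cases p rule: sign_cases) simp_all
qed

section \<open>Systems of polynomial equations in countably many unknowns\<close>

text \<open>A monomial is determined by the graph of its exponents over its finite support, and a countable
  set has only countably many finite subsets.\<close>

lemma countable_monomials: "countable (UNIV :: ('v::countable \<Rightarrow>\<^sub>0 nat) set)"
proof -
  let ?g = "\<lambda>m :: 'v \<Rightarrow>\<^sub>0 nat. (\<lambda>v. (v, Poly_Mapping.lookup m v)) ` Poly_Mapping.keys m"
  have "inj ?g"
  proof (rule injI, rule poly_mapping_eqI)
    fix m n :: "'v \<Rightarrow>\<^sub>0 nat" and v assume eq: "?g m = ?g n"
    show "Poly_Mapping.lookup m v = Poly_Mapping.lookup n v"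
    proof (cases "v \<in> Poly_Mapping.keys m \<or> v \<in> Poly_Mapping.keys n")
      case True
      then have "(v, Poly_Mapping.lookup m v) \<in> ?g n \<or> (v, Poly_Mapping.lookup n v) \<in> ?g m"
        using eq by blast
      then show ?thesis by auto
    next
      case False
      then show ?thesis by (simp add: in_keys_iff)
    qed
  qed
  moreover have "countable (range ?g)"
    by (rule countable_subset[OF _ countable_Collect_finite]) auto
  ultimately show ?thesis using countable_image_inj_on by blast
qed

text \<open>The ideal \<open>J\<close> below is not the one generated by \<open>P\<close> but the possibly larger set of consequences
  of finite subsystems. It is visibly an ideal, and finite satisfiability says exactly that it
  does not contain \<open>1\<close>.\<close>

lemma common_zero_of_finitely_satisfiable:
  fixes P :: "'v::countable mpoly set"
  assumes fin: "\<And>F. finite F \<Longrightarrow> F \<subseteq> P \<Longrightarrow> \<exists>x. \<forall>p\<in>F. mpoly_eval p x = 0"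
  shows "\<exists>x. \<forall>p\<in>P. mpoly_eval p x = 0"
proof -
  interpret c: comm_ring_hom "mconst :: complex \<Rightarrow> 'v mpoly" by (rule comm_ring_hom_mconst)
  define J where "J = {r. \<exists>F\<subseteq>P. finite F \<and>
    (\<forall>x. (\<forall>p\<in>F. mpoly_eval p x = 0) \<longrightarrow> mpoly_eval r x = 0)}"
  have JI: "r \<in> J" if "F \<subseteq> P" "finite F"
    "\<And>x. (\<forall>p\<in>F. mpoly_eval p x = 0) \<Longrightarrow> mpoly_eval r x = 0" for F r
    using that unfolding J_def by blast
  have PJ: "P \<subseteq> J"
  proof
    fix p assume "p \<in> P" then show "p \<in> J" by (intro JI[of "{p}"]) auto
  qed
  have J: "ring_ideal J"
  proof (rule ring_idealI)
    show "0 \<in> J" by (rule JI[of "{}"]) (auto simp: mpoly_eval_zero)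
  next
    fix r s assume "r \<in> J" "s \<in> J"
    then obtain F F' where "F \<subseteq> P" "finite F" "F' \<subseteq> P" "finite F'"
      "\<And>x. (\<forall>p\<in>F. mpoly_eval p x = 0) \<Longrightarrow> mpoly_eval r x = 0"
      "\<And>x. (\<forall>p\<in>F'. mpoly_eval p x = 0) \<Longrightarrow> mpoly_eval s x = 0"
      unfolding J_def by blast
    then show "r + s \<in> J" by (intro JI[of "F \<union> F'"]) (auto simp: mpoly_eval_add)
  next
    fix t r assume "r \<in> J"
    then show "t * r \<in> J" unfolding J_def by (auto simp: mpoly_eval_mult)
  qed
  have "1 \<notin> J"
  proof
    assume "1 \<in> J"
    then obtain F where F: "F \<subseteq> P" "finite F"
      "\<And>x. (\<forall>p\<in>F. mpoly_eval p x = 0) \<Longrightarrow> mpoly_eval 1 x = 0" unfolding J_def by blast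
    then obtain x where "\<forall>p\<in>F. mpoly_eval p x = 0" using fin by blast
    then have "mpoly_eval 1 x = 0" using F by blast
    then show False using mpoly_eval_const[of 1 x] by (simp add: single_one)
  qed
  with J obtain M where M: "J \<subseteq> M" "ring_ideal M" "1 \<notin> M"
    "\<And>x. x \<notin> M \<Longrightarrow> \<exists>q. q * x - 1 \<in> M" by (rule exists_maximal_ideal) blast
  interpret vs: vector_space "\<lambda>a r. mconst a * r :: 'v mpoly"
    by standard (simp_all add: algebra_simps c.hom_add c.hom_mult)
  let ?B = "range (\<lambda>m. Poly_Mapping.single m 1) :: 'v mpoly set"
  have "p \<in> vs.span ?B" for p
  proof -
    have "(\<Sum>m\<in>Poly_Mapping.keys p. mconst (Poly_Mapping.lookup p m) * Poly_Mapping.single m 1)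
      \<in> vs.span ?B"
      by (intro vs.span_sum vs.span_scale vs.span_base) auto
    then show ?thesis by (simp add: mult_single flip: poly_mapping_sum_single)
  qed
  then have span: "vs.span ?B = UNIV" by auto
  have "countable ?B" using countable_monomials by blast
  then have "\<exists>a. p - mconst a \<in> M" for p
    by (rule maximal_ideal_residue_scalar[OF comm_ring_hom_mconst _ span M(2-4)])
  then have "\<forall>v. \<exists>a. mvar v - mconst a \<in> M" by blast
  from choice[OF this] obtain y where y: "\<And>v. mvar v - mconst (y v) \<in> M" by blast
  \<comment> \<open>Modulo \<open>M\<close> the indeterminates are the scalars \<open>y v\<close>, so reduction modulo \<open>M\<close> is evaluation at \<open>y\<close>.\<close>
  have ev: "p - mconst (mpoly_eval p y) \<in> M" for p
  proof (induction p rule: mpoly_induct)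
    case (const a)
    then show ?case using ring_ideal_zero[OF M(2)] by simp
  next
    case (var v)
    then show ?case using y by simp
  next
    case (add p q)
    from ring_ideal_add[OF M(2) this] show ?case
      by (simp add: mpoly_eval_add single_add algebra_simps)
  next
    case (mult p q)
    let ?p = "mconst (mpoly_eval p y) :: 'v mpoly" and ?q = "mconst (mpoly_eval q y) :: 'v mpoly"
    have "q * (p - ?p) + ?p * (q - ?q) \<in> M"
      using mult ring_ideal_add[OF M(2)] ring_ideal_mult[OF M(2)] by blast
    also have "q * (p - ?p) + ?p * (q - ?q) = p * q - ?p * ?q"
      by (simp only: ring_distribs ac_simps) simp
    also have "?p * ?q = mconst (mpoly_eval (p * q) y)" by (simp add: mpoly_eval_mult mult_single)
    finally show ?case .
  qed
  have "mpoly_eval p y = 0" if "p \<in> P" for p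
  proof (rule ccontr)
    let ?e = "mpoly_eval p y"
    assume ne: "?e \<noteq> 0"
    have "p \<in> M" using PJ M(1) that by blast
    from ring_ideal_diff[OF M(2) this ev[of p]] have "mconst ?e \<in> M" by simp
    then have "mconst (inverse ?e) * mconst ?e \<in> M" by (rule ring_ideal_mult[OF M(2)])
    then show False using ne M(3) by (simp add: mult_single single_one)
  qed
  then show ?thesis by blast
qed

section \<open>Countability of finitely generated groups\<close>

text \<open>The generated set is exhausted by the sets \<open>A k\<close>, which start with the generators and their inverses
  and grow by products of two earlier elements.\<close>

lemma countable_generate:
  assumes "countable H"
  shows "countable (generate G H)"
proof -
  define A where "A = rec_nat (insert \<one>\<^bsub>G\<^esub> (H \<union> m_inv G ` H))
    (\<lambda>_ X. X \<union> (\<lambda>(x, y). x \<otimes>\<^bsub>G\<^esub> y) ` (X \<times> X))"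
  have A0: "A 0 = insert \<one>\<^bsub>G\<^esub> (H \<union> m_inv G ` H)"
    and AS: "\<And>k. A (Suc k) = A k \<union> (\<lambda>(x, y). x \<otimes>\<^bsub>G\<^esub> y) ` (A k \<times> A k)"
    by (simp_all add: A_def)
  have "countable (A k)" for k
    by (induction k) (auto simp: A0 AS assms)
  then have "countable (\<Union>k. A k)" by blast
  moreover have "generate G H \<subseteq> (\<Union>k. A k)"
  proof
    fix x assume "x \<in> generate G H"
    then show "x \<in> (\<Union>k. A k)"
    proof induction
      case (eng x y)
      then obtain k l where kl: "x \<in> A k" "y \<in> A l" by auto
      have mono: "A i \<subseteq> A j" if "i \<le> j" for i j
        using that by (rule lift_Suc_mono_le[rotated]) (auto simp: AS)
      have "x \<in> A (max k l)" "y \<in> A (max k l)"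
        using kl mono[of k "max k l"] mono[of l "max k l"] by auto
      then have "x \<otimes>\<^bsub>G\<^esub> y \<in> A (Suc (max k l))" by (auto simp: AS)
      then show ?case by blast
    qed (use A0 in auto)
  qed
  ultimately show ?thesis by (rule countable_subset[rotated])
qed

section \<open>Special linear representations\<close>

lemma carrier_SL: "carrier (SL n) = {A \<in> carrier_mat n n. det A = 1}"
  by (simp add: SL_def)

lemma mult_SL: "A \<otimes>\<^bsub>SL n\<^esub> B = A * B"
  by (simp add: SL_def)

lemma hom_SL_I:
  assumes "\<And>x. x \<in> carrier G \<Longrightarrow> \<rho> x \<in> carrier_mat n n"
    and "\<And>x. x \<in> carrier G \<Longrightarrow> det (\<rho> x) = 1"
    and "\<And>x y. x \<in> carrier G \<Longrightarrow> y \<in> carrier G \<Longrightarrow> \<rho> (x \<otimes>\<^bsub>G\<^esub> y) = \<rho> x * \<rho> y"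
  shows "\<rho> \<in> hom G (SL n)"
  using assms by (auto simp: hom_def carrier_SL mult_SL)

lemma
  assumes "\<rho> \<in> hom G (SL n)" "x \<in> carrier G"
  shows hom_SL_carrier: "\<rho> x \<in> carrier_mat n n" and hom_SL_det: "det (\<rho> x) = 1"
  using assms by (auto simp: hom_def carrier_SL)

lemma hom_SL_mult:
  "\<rho> \<in> hom G (SL n) \<Longrightarrow> x \<in> carrier G \<Longrightarrow> y \<in> carrier G \<Longrightarrow> \<rho> (x \<otimes>\<^bsub>G\<^esub> y) = \<rho> x * \<rho> y"
  by (auto simp: hom_def mult_SL)

lemma adj_mat_mult_det_one:
  assumes A: "A \<in> carrier_mat n n" "det A = 1"
  shows "adj_mat A * A = 1\<^sub>m n"
  using adj_mat(3)[OF A(1)] A(2) by (auto intro!: eq_matI)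

text \<open>Gives the values of a representation at the identity and at inverses as polynomial expressions,
  with the adjugate matrix in the role of the inverse.\<close>

lemma solve_left_mult_det_one:
  assumes A: "A \<in> carrier_mat n n" "det A = 1" and B: "B \<in> carrier_mat n n" and "A * B = D"
  shows "B = adj_mat A * D"
proof -
  have "adj_mat A * D = (adj_mat A * A) * B"
    unfolding assms(4)[symmetric]
    by (rule assoc_mult_mat[symmetric]) (rule adj_mat(1)[OF A(1)] A(1) B)+
  also have "\<dots> = B" using adj_mat_mult_det_one[OF A] B by simp
  finally show ?thesis by simp
qed

context group
begin

lemma hom_SL_one:
  assumes r: "\<rho> \<in> hom G (SL n)"
  shows "\<rho> \<one> = 1\<^sub>m n"
proof -
  note c = hom_SL_carrier[OF r one_closed] hom_SL_det[OF r one_closed]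
  have "\<rho> \<one> * \<rho> \<one> = \<rho> \<one>" using hom_SL_mult[OF r one_closed one_closed] by simp
  from solve_left_mult_det_one[OF c c(1) this] show ?thesis using adj_mat_mult_det_one[OF c] by simp
qed

lemma hom_SL_inv:
  assumes r: "\<rho> \<in> hom G (SL n)" and x: "x \<in> carrier G"
  shows "\<rho> (inv x) = adj_mat (\<rho> x)"
proof -
  note c = hom_SL_carrier[OF r x] hom_SL_det[OF r x]
  have "\<rho> x * \<rho> (inv x) = 1\<^sub>m n"
    using hom_SL_mult[OF r x, of "inv x"] x hom_SL_one[OF r] by simp
  from solve_left_mult_det_one[OF c hom_SL_carrier[OF r] this] show ?thesis
    using adj_mat(1)[OF c(1)] x by simp
qed

lemma conjugate_in_sym:
  assumes "x \<in> carrier G" "conjugate_in G x y"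
  shows "conjugate_in G y x"
proof -
  obtain g where g: "g \<in> carrier G" "y = g \<otimes> x \<otimes> inv g"
    using assms by (auto simp: conjugate_in_def)
  then have "x = inv g \<otimes> y \<otimes> inv (inv g)" using assms(1)
    by (simp add: m_assoc inv_solve_left)
  then show ?thesis using g unfolding conjugate_in_def by blast
qed

lemma conjugate_in_trans:
  assumes "x \<in> carrier G" "conjugate_in G x y" "conjugate_in G y z"
  shows "conjugate_in G x z"
proof -
  obtain g h where g: "g \<in> carrier G" "y = g \<otimes> x \<otimes> inv g" "h \<in> carrier G" "z = h \<otimes> y \<otimes> inv h"
    using assms by (auto simp: conjugate_in_def)
  then have "z = (h \<otimes> g) \<otimes> x \<otimes> inv (h \<otimes> g)" using assms(1)
    by (simp add: m_assoc inv_mult_group)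
  then show ?thesis using g unfolding conjugate_in_def by blast
qed

lemma conjugate_in_refl: "x \<in> carrier G \<Longrightarrow> conjugate_in G x x"
  unfolding conjugate_in_def by (intro bexI[of _ \<one>]) auto

lemma conjugate_in_closed: "x \<in> carrier G \<Longrightarrow> conjugate_in G x y \<Longrightarrow> y \<in> carrier G"
  by (auto simp: conjugate_in_def)

end

lemma Tr_mult_commute:
  assumes "A \<in> carrier_mat n n" "B \<in> carrier_mat n n"
  shows "Tr (A * B) = Tr (B * A)"
proof -
  have "Tr (A * B) = (\<Sum>i<n. \<Sum>j<n. A $$ (i, j) * B $$ (j, i))"
    using assms by (auto simp: Tr_def scalar_prod_def atLeast0LessThan intro!: sum.cong)
  also have "\<dots> = (\<Sum>j<n. \<Sum>i<n. B $$ (j, i) * A $$ (i, j))"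
    by (subst sum.swap) (simp add: mult.commute)
  also have "\<dots> = Tr (B * A)"
    using assms by (auto simp: Tr_def scalar_prod_def atLeast0LessThan intro!: sum.cong)
  finally show ?thesis .
qed

lemma (in group) Tr_conjugate:
  assumes r: "\<rho> \<in> hom G (SL n)" and x: "x \<in> carrier G" and "conjugate_in G x y"
  shows "Tr (\<rho> y) = Tr (\<rho> x)"
proof -
  obtain g where g: "g \<in> carrier G" "y = g \<otimes> x \<otimes> inv g"
    using assms by (auto simp: conjugate_in_def)
  have "Tr (\<rho> y) = Tr (\<rho> (g \<otimes> x) * \<rho> (inv g))" using g x hom_SL_mult[OF r] by simp
  also have "\<dots> = Tr (\<rho> (inv g) * \<rho> (g \<otimes> x))"
    using g x hom_SL_carrier[OF r] by (intro Tr_mult_commute) auto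
  also have "\<dots> = Tr (\<rho> (inv g \<otimes> (g \<otimes> x)))" using g x hom_SL_mult[OF r] by simp
  also have "inv g \<otimes> (g \<otimes> x) = x" using g x by (simp flip: m_assoc)
  finally show ?thesis .
qed

text \<open>Adding a trivial summand of dimension \<open>N - n\<close> changes all traces by the same amount, so it does
  not affect which elements are separated.\<close>

lemma pad_hom_SL:
  assumes r: "\<rho> \<in> hom G (SL n)" and "n \<le> N"
  obtains \<rho>' where "\<rho>' \<in> hom G (SL N)"
    "\<And>x. x \<in> carrier G \<Longrightarrow> Tr (\<rho>' x) = Tr (\<rho> x) + of_nat (N - n)"
proof
  define k where "k = N - n"
  have N: "N = n + k" using assms by (simp add: k_def)
  let ?b = "\<lambda>x. four_block_mat (\<rho> x) (0\<^sub>m n k) (0\<^sub>m k n) (1\<^sub>m k)"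
  note c = hom_SL_carrier[OF r]
  show "?b \<in> hom G (SL N)"
  proof (rule hom_SL_I)
    fix x assume x: "x \<in> carrier G"
    show "?b x \<in> carrier_mat N N" unfolding N using c[OF x] by auto
    show "det (?b x) = 1"
      using c[OF x] hom_SL_det[OF r x] by (subst det_four_block_mat_upper_right_zero) auto
    fix y assume y: "y \<in> carrier G"
    show "?b (x \<otimes>\<^bsub>G\<^esub> y) = ?b x * ?b y"
      using c[OF x] c[OF y]
      by (subst mult_four_block_mat[of _ n n _ k _ k _ _ n _ k]) (auto simp: hom_SL_mult[OF r x y])
  qed
  fix x assume x: "x \<in> carrier G"
  have d: "dim_row (\<rho> x) = n" "dim_col (\<rho> x) = n" using c[OF x] by auto
  have "Tr (?b x) = (\<Sum>i<n + k. if i < n then \<rho> x $$ (i, i) else 1)"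
    unfolding Tr_def by (auto simp: d intro!: sum.cong)
  also have "{..<n + k} = {..<n} \<union> {n..<n + k}" by auto
  also have "(\<Sum>i\<in>\<dots>. if i < n then \<rho> x $$ (i, i) else 1) = Tr (\<rho> x) + of_nat k"
    by (subst sum.union_disjoint) (auto simp: Tr_def d)
  finally show "Tr (?b x) = Tr (\<rho> x) + of_nat (N - n)" by (simp add: k_def)
qed

section \<open>Separating finitely many pairs at a time\<close>

definition nonconjugate_pairs :: "('a, 'b) monoid_scheme \<Rightarrow> ('a \<times> 'a) set" where
  "nonconjugate_pairs G = {(x, y). x \<in> carrier G \<and> y \<in> carrier G \<and> \<not> conjugate_in G x y}"

text \<open>The unknowns are \<open>Inl (k, i, j)\<close>, for the entry \<open>(i, j)\<close> of the image of the group element number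
  \<open>k\<close>, and \<open>Inr (k, l)\<close>, for the inverse of the difference of the traces at the elements number
  \<open>k\<close> and \<open>l\<close>. The unknowns \<open>Inr\<close> turn the countably many inequations between traces into equations.
  Since every group element has its own unknowns, the relations of the group are all among the
  multiplicativity equations.\<close>

lemma property_A_if_finitely_separated:
  fixes G :: "('a, 'b) monoid_scheme" (structure)
  assumes G: "group G" "countable (carrier G)" and n: "n \<ge> 1"
    and fin: "\<And>F. finite F \<Longrightarrow> F \<subseteq> nonconjugate_pairs G \<Longrightarrow>
      \<exists>\<rho>\<in>hom G (SL n). \<forall>(x, y)\<in>F. Tr (\<rho> x) \<noteq> Tr (\<rho> y)"
  shows "property_A G"
proof -
  interpret group G by fact
  define t where "t = to_nat_on (carrier G)"
  define e where "e = from_nat_into (carrier G)"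
  have et: "\<And>g. g \<in> carrier G \<Longrightarrow> e (t g) = g" using G(2) by (simp add: e_def t_def)
  define X :: "'a \<Rightarrow> ((nat \<times> nat \<times> nat) + (nat \<times> nat)) mpoly mat" where
    "X g = mat n n (\<lambda>(i, j). mvar (Inl (t g, i, j)))" for g
  define T where "T g = (\<Sum>i<n. X g $$ (i, i))" for g
  have X: "\<And>g. X g \<in> carrier_mat n n" by (simp add: X_def)
  \<comment> \<open>Determinant one, multiplicativity, and separation of non-conjugate pairs.\<close>
  define D where "D g = det (X g) - 1" for g
  define E where "E = (\<lambda>(g, h, i, j). (X g * X h) $$ (i, j) - X (g \<otimes> h) $$ (i, j))"
  define S where "S = (\<lambda>(g, h). mvar (Inr (t g, t h)) * (T g - T h) - 1)"
  let ?I = "carrier G \<times> carrier G \<times> {..<n} \<times> {..<n}"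
  define A where "A x g = map_mat (\<lambda>p. mpoly_eval p x) (X g)" for x g
  have A: "\<And>x g. A x g \<in> carrier_mat n n" by (simp add: A_def X_def)
  have evD: "mpoly_eval (D g) x = det (A x g) - 1" for g x
  proof -
    interpret ev: comm_ring_hom "\<lambda>p. mpoly_eval p x" by (rule comm_ring_hom_mpoly_eval)
    show ?thesis by (simp add: D_def A_def ev.hom_minus ev.hom_det)
  qed
  have evE: "mpoly_eval (E (g, h, i, j)) x = (A x g * A x h) $$ (i, j) - A x (g \<otimes> h) $$ (i, j)"
    if "i < n" "j < n" for g h i j x
  proof -
    interpret ev: comm_ring_hom "\<lambda>p. mpoly_eval p x" by (rule comm_ring_hom_mpoly_eval)
    have "A x g * A x h = map_mat (\<lambda>p. mpoly_eval p x) (X g * X h)"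
      unfolding A_def by (rule ev.mat_hom_mult[OF X X, symmetric])
    then show ?thesis using that X[of g] X[of h] X[of "g \<otimes> h"]
      by (simp add: E_def A_def ev.hom_minus)
  qed
  have evT: "mpoly_eval (T g) x = Tr (A x g)" for g x
    using X[of g] by (auto simp: T_def Tr_def A_def mpoly_eval_sum intro!: sum.cong)
  have evS: "mpoly_eval (S (g, h)) x = x (Inr (t g, t h)) * (Tr (A x g) - Tr (A x h)) - 1" for g h x
  proof -
    interpret ev: comm_ring_hom "\<lambda>p. mpoly_eval p x" by (rule comm_ring_hom_mpoly_eval)
    show ?thesis by (simp add: S_def ev.hom_minus ev.hom_mult evT)
  qed
  have "\<exists>x. \<forall>p\<in>D ` carrier G \<union> E ` ?I \<union> S ` nonconjugate_pairs G. mpoly_eval p x = 0"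
  proof (rule common_zero_of_finitely_satisfiable)
    fix F assume F: "finite F" "F \<subseteq> D ` carrier G \<union> E ` ?I \<union> S ` nonconjugate_pairs G"
    have "finite (F \<inter> S ` nonconjugate_pairs G)" "F \<inter> S ` nonconjugate_pairs G \<subseteq> S ` nonconjugate_pairs G"
      using F by auto
    from finite_subset_image[OF this] obtain Q where
      Q: "Q \<subseteq> nonconjugate_pairs G" "finite Q" "F \<inter> S ` nonconjugate_pairs G = S ` Q" by blast
    obtain \<rho> where r: "\<rho> \<in> hom G (SL n)" and sep: "\<And>g h. (g, h) \<in> Q \<Longrightarrow> Tr (\<rho> g) \<noteq> Tr (\<rho> h)"
      using fin[OF Q(2,1)] by blast
    \<comment> \<open>For a pair outside \<open>Q\<close> the value of the unknown \<open>Inr\<close> may be the meaningless \<open>inverse 0\<close>, but its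
      equation does not belong to \<open>F\<close>.\<close>
    define x where "x = case_sum (\<lambda>(k, i, j). \<rho> (e k) $$ (i, j))
      (\<lambda>(k, l). inverse (Tr (\<rho> (e k)) - Tr (\<rho> (e l))))"
    have Ax: "A x g = \<rho> g" if "g \<in> carrier G" for g
      using hom_SL_carrier[OF r that] that by (intro eq_matI) (auto simp: A_def X_def x_def et)
    have "mpoly_eval p x = 0" if p: "p \<in> F" for p
    proof -
      have "p \<in> S ` Q" if "p \<in> S ` nonconjugate_pairs G"
        using p that Q(3)[symmetric] by simp
      then consider "p \<in> D ` carrier G" | "p \<in> E ` ?I" | "p \<in> S ` Q"
        using subsetD[OF F(2) p] by (elim UnE) simp_all
      then show ?thesis
      proof cases
        case 1
        then obtain g where "g \<in> carrier G" "p = D g" by (elim imageE)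
        then show ?thesis using hom_SL_det[OF r] by (simp add: evD Ax)
      next
        case 2
        then obtain g h i j where "g \<in> carrier G" "h \<in> carrier G" "i < n" "j < n" "p = E (g, h, i, j)"
          by auto
        then show ?thesis using hom_SL_mult[OF r] by (simp add: evE Ax)
      next
        case 3
        then obtain g h where gh: "(g, h) \<in> Q" "p = S (g, h)" by auto
        then have "g \<in> carrier G" "h \<in> carrier G" using Q(1) by (auto simp: nonconjugate_pairs_def)
        then show ?thesis using sep[OF gh(1)] unfolding gh(2) evS
          by (simp add: Ax) (simp add: x_def et)
      qed
    qed
    then show "\<exists>x. \<forall>p\<in>F. mpoly_eval p x = 0" by blast
  qed
  then obtain x where
    x: "\<And>g. g \<in> carrier G \<Longrightarrow> mpoly_eval (D g) x = 0"
      "\<And>i. i \<in> ?I \<Longrightarrow> mpoly_eval (E i) x = 0"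
      "\<And>i. i \<in> nonconjugate_pairs G \<Longrightarrow> mpoly_eval (S i) x = 0" by blast
  have "A x \<in> hom G (SL n)"
  proof (rule hom_SL_I[OF A])
    show "det (A x g) = 1" if "g \<in> carrier G" for g using x(1)[OF that] by (simp add: evD)
    show "A x (g \<otimes> h) = A x g * A x h" if "g \<in> carrier G" "h \<in> carrier G" for g h
    proof (rule eq_matI)
      fix i j assume "i < dim_row (A x g * A x h)" "j < dim_col (A x g * A x h)"
      then have ij: "i < n" "j < n" using A[of x g] A[of x h] by auto
      then show "A x (g \<otimes> h) $$ (i, j) = (A x g * A x h) $$ (i, j)"
        using x(2)[of "(g, h, i, j)"] that evE[OF ij, of g h x] by simp
    qed (use A[of x g] A[of x h] A[of x "g \<otimes> h"] in auto)
  qed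
  moreover have "Tr (A x g) \<noteq> Tr (A x h)"
    if "g \<in> carrier G" "h \<in> carrier G" "\<not> conjugate_in G g h" for g h
    using x(3)[of "(g, h)"] that by (auto simp: nonconjugate_pairs_def evS)
  ultimately show ?thesis unfolding property_A_def using n by blast
qed

text \<open>Traces are constant on conjugacy classes, so separating pairs amounts to separating the chosen
  representatives \<open>r x\<close> of their classes.\<close>

lemma finitely_separated_if_uniformly_C:
  assumes "group G" "uniformly_C G"
  obtains N where "N \<ge> 1" "\<And>F. finite F \<Longrightarrow> F \<subseteq> nonconjugate_pairs G \<Longrightarrow>
      \<exists>\<rho>\<in>hom G (SL N). \<forall>(x, y)\<in>F. Tr (\<rho> x) \<noteq> Tr (\<rho> y)"
proof -
  interpret group G by fact
  obtain N where N: "\<And>S. class_representatives G S \<Longrightarrow>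
        (\<exists>n. 1 \<le> n \<and> n \<le> N \<and>
          (\<exists>\<rho>\<in>hom G (SL n). \<forall>x\<in>S. \<forall>y\<in>S. x \<noteq> y \<longrightarrow> Tr (\<rho> x) \<noteq> Tr (\<rho> y)))"
    using assms(2) unfolding uniformly_C_def by blast
  define r where "r x = (SOME y. conjugate_in G x y)" for x
  have r: "conjugate_in G x (r x)" if "x \<in> carrier G" for x
    unfolding r_def using conjugate_in_refl[OF that] by (rule someI)
  have r_eq: "r x = r y" if "x \<in> carrier G" "y \<in> carrier G" "conjugate_in G x y" for x y
  proof -
    have "conjugate_in G x z = conjugate_in G y z" for z
      using that conjugate_in_sym conjugate_in_trans by blast
    then show ?thesis by (simp add: r_def)
  qed
  show ?thesis
  proof
    have "class_representatives G {}" by (simp add: class_representatives_def)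
    then show "N \<ge> 1" using N by fastforce
  next
    fix F assume F: "finite F" "F \<subseteq> nonconjugate_pairs G"
    define S where "S = r ` (fst ` F \<union> snd ` F)"
    have FG: "fst ` F \<union> snd ` F \<subseteq> carrier G" using F(2) by (auto simp: nonconjugate_pairs_def)
    have "class_representatives G S"
      unfolding class_representatives_def
    proof (intro conjI ballI impI notI)
      show "finite S" using F by (simp add: S_def)
      show "S \<subseteq> carrier G" using FG r conjugate_in_closed by (auto simp: S_def)
    next
      fix u v assume "u \<in> S" "v \<in> S" "u \<noteq> v" "conjugate_in G u v"
      then obtain x y where xy: "x \<in> carrier G" "y \<in> carrier G" "u = r x" "v = r y"
        using FG unfolding S_def by blast
      have "conjugate_in G x (r y)"
        using xy r conjugate_in_trans \<open>conjugate_in G u v\<close> by blast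
      moreover have "conjugate_in G (r y) y" using xy r conjugate_in_sym by blast
      ultimately have "r x = r y" using xy r_eq conjugate_in_trans by blast
      then show False using xy \<open>u \<noteq> v\<close> by simp
    qed
    then obtain n \<rho> where n: "n \<le> N" "\<rho> \<in> hom G (SL n)"
      and sep: "\<And>x y. x \<in> S \<Longrightarrow> y \<in> S \<Longrightarrow> x \<noteq> y \<Longrightarrow> Tr (\<rho> x) \<noteq> Tr (\<rho> y)"
      using N by metis
    obtain \<rho>' where r': "\<rho>' \<in> hom G (SL N)"
      "\<And>x. x \<in> carrier G \<Longrightarrow> Tr (\<rho>' x) = Tr (\<rho> x) + of_nat (N - n)"
      using pad_hom_SL[OF n(2,1)] by metis
    have "Tr (\<rho>' x) \<noteq> Tr (\<rho>' y)" if xy: "(x, y) \<in> F" for x y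
    proof -
      have c: "x \<in> carrier G" "y \<in> carrier G" "\<not> conjugate_in G x y"
        using xy F(2) by (auto simp: nonconjugate_pairs_def)
      have "r x \<in> S" "r y \<in> S" using xy unfolding S_def by force+
      moreover have "r x \<noteq> r y"
        using c r conjugate_in_sym conjugate_in_trans by metis
      ultimately have "Tr (\<rho> (r x)) \<noteq> Tr (\<rho> (r y))" by (rule sep)
      then show ?thesis using c r r'(2) Tr_conjugate[OF n(2)] by simp
    qed
    then show "\<exists>\<rho>\<in>hom G (SL N). \<forall>(x, y)\<in>F. Tr (\<rho> x) \<noteq> Tr (\<rho> y)" using r'(1) by blast
  qed
qed

section \<open>Irreducible representation varieties\<close>

text \<open>An irreducible set is not covered by finitely many proper closed subsets. The closed set
  belonging to the product of the polynomials treated so far is the union of their zero sets.\<close>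

lemma zariski_irreducible_common_nonzero:
  assumes irr: "zariski_irreducible I V" and V: "V \<subseteq> I \<rightarrow>\<^sub>E UNIV"
    and "finite Q" "Q \<subseteq> mpolys_in I" "\<And>q. q \<in> Q \<Longrightarrow> \<exists>x\<in>V. mpoly_eval q x \<noteq> 0"
  shows "\<exists>x\<in>V. \<forall>q\<in>Q. mpoly_eval q x \<noteq> 0"
  using assms(3-5)
proof (induction Q rule: finite_induct)
  case empty
  then show ?case using irr by (auto simp: zariski_irreducible_def)
next
  case (insert q Q)
  let ?Z = "\<lambda>p. {x \<in> I \<rightarrow>\<^sub>E UNIV. mpoly_eval p x = 0}"
  have closed: "zariski_closed I (?Z p)" if "p \<in> mpolys_in I" for p
    unfolding zariski_closed_def using that by (intro exI[of _ "{p}"]) auto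
  have prod: "mpoly_eval (\<Prod>Q) x = (\<Prod>p\<in>Q. mpoly_eval p x)" for x
  proof -
    interpret ev: comm_ring_hom "\<lambda>p. mpoly_eval p x" by (rule comm_ring_hom_mpoly_eval)
    show ?thesis by (simp add: ev.hom_prod)
  qed
  have "\<Prod>Q \<in> mpolys_in I" using insert by (intro mpolys_in_prod) auto
  then have c: "zariski_closed I (?Z q)" "zariski_closed I (?Z (\<Prod>Q))"
    using closed insert by auto
  have "\<not> V \<subseteq> ?Z q" using insert.prems by auto
  moreover have "\<exists>x\<in>V. \<forall>q\<in>Q. mpoly_eval q x \<noteq> 0"
    using insert by auto
  then have "\<not> V \<subseteq> ?Z (\<Prod>Q)" using insert.hyps by (fastforce simp: prod)
  ultimately have "\<not> V \<subseteq> ?Z q \<union> ?Z (\<Prod>Q)"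
    using irr c unfolding zariski_irreducible_def by blast
  then obtain x where "x \<in> V" "x \<notin> ?Z q" "x \<notin> ?Z (\<Prod>Q)" by blast
  then have "x \<in> V" "mpoly_eval q x \<noteq> 0" "\<forall>p\<in>Q. mpoly_eval p x \<noteq> 0"
    using V insert.hyps by (auto simp: prod)
  then show ?case by blast
qed

lemma (in comm_ring_hom) hom_adj_mat:
  assumes "A \<in> carrier_mat n n"
  shows "map_mat hom (adj_mat A) = adj_mat (map_mat hom A)"
proof (rule eq_matI)
  fix i j assume "i < dim_row (adj_mat (map_mat hom A))" "j < dim_col (adj_mat (map_mat hom A))"
  then have ij: "i < n" "j < n" using assms by (auto simp: adj_mat_def)
  have "map_mat hom (mat_delete A j i) = mat_delete (map_mat hom A) j i"
    using assms ij by (intro eq_matI) (auto simp: mat_delete_def)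
  then have "hom (det (mat_delete A j i)) = det (mat_delete (map_mat hom A) j i)"
    by (metis hom_det)
  then show "map_mat hom (adj_mat A) $$ (i, j) = adj_mat (map_mat hom A) $$ (i, j)"
    using assms ij
    by (simp add: adj_mat_def cofactor_def hom_mult hom_power hom_uminus)
qed (use assms in \<open>auto simp: adj_mat_def\<close>)

text \<open>Makes evaluation at \<open>g\<close> a polynomial map on the representation variety: a single
  matrix \<open>M\<close> of polynomials expresses \<open>\<rho> g\<close> through the images of the generators, uniformly in \<open>\<rho>\<close>. Inverses are polynomial because the determinants are \<open>1\<close>.\<close>

lemma (in group) representation_polynomial_in_generators:
  assumes gs: "set gs \<subseteq> carrier G" and g: "g \<in> generate G (set gs)"
  shows "\<exists>M\<in>carrier_mat n n. (\<forall>i<n. \<forall>j<n. M $$ (i, j) \<in> mpolys_in (hom_coords gs n)) \<and>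
    (\<forall>\<rho>\<in>hom G (SL n). \<rho> g = map_mat (\<lambda>p. mpoly_eval p (hom_point gs n \<rho>)) M)"
  using g
proof (induction g rule: generate.induct)
  case one
  show ?case
  proof (intro bexI[of _ "1\<^sub>m n"] conjI allI impI ballI)
    fix \<rho> assume r: "\<rho> \<in> hom G (SL n)"
    interpret ev: comm_ring_hom "\<lambda>p. mpoly_eval p (hom_point gs n \<rho>)" by (rule comm_ring_hom_mpoly_eval)
    show "\<rho> \<one> = map_mat (\<lambda>p. mpoly_eval p (hom_point gs n \<rho>)) (1\<^sub>m n)"
      by (simp add: hom_SL_one[OF r] ev.mat_hom_one)
  qed (auto simp: mpolys_in_zero mpolys_in_one)
next
  case (incl h)
  then obtain k where k: "k < length gs" "gs ! k = h" by (auto simp: in_set_conv_nth)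
  show ?case
  proof (intro bexI[of _ "mat n n (\<lambda>(i, j). mvar (k, i, j))"] conjI allI impI ballI)
    fix \<rho> assume r: "\<rho> \<in> hom G (SL n)"
    have "\<rho> h \<in> carrier_mat n n" using incl gs hom_SL_carrier[OF r] by auto
    then show "\<rho> h = map_mat (\<lambda>p. mpoly_eval p (hom_point gs n \<rho>)) (mat n n (\<lambda>(i, j). mvar (k, i, j)))"
      using k by (intro eq_matI) (auto simp: hom_point_def hom_coords_def)
  qed (use k in \<open>auto simp: hom_coords_def intro!: mvar_in\<close>)
next
  case (inv h)
  then obtain k where k: "k < length gs" "gs ! k = h" by (auto simp: in_set_conv_nth)
  define M :: "(nat \<times> nat \<times> nat) mpoly mat" where "M = mat n n (\<lambda>(i, j). mvar (k, i, j))"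
  have M: "M \<in> carrier_mat n n" by (simp add: M_def)
  have Mi: "\<And>i j. i < n \<Longrightarrow> j < n \<Longrightarrow> M $$ (i, j) \<in> mpolys_in (hom_coords gs n)"
    using k by (auto simp: M_def hom_coords_def intro!: mvar_in)
  show ?case
  proof (intro bexI[of _ "adj_mat M"] conjI allI impI ballI)
    fix \<rho> assume r: "\<rho> \<in> hom G (SL n)"
    interpret ev: comm_ring_hom "\<lambda>p. mpoly_eval p (hom_point gs n \<rho>)" by (rule comm_ring_hom_mpoly_eval)
    have h: "h \<in> carrier G" using inv gs by auto
    have "\<rho> h = map_mat (\<lambda>p. mpoly_eval p (hom_point gs n \<rho>)) M"
      using k hom_SL_carrier[OF r h] by (intro eq_matI) (auto simp: M_def hom_point_def hom_coords_def)
    then show "\<rho> (inv h) = map_mat (\<lambda>p. mpoly_eval p (hom_point gs n \<rho>)) (adj_mat M)"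
      using hom_SL_inv[OF r h] ev.hom_adj_mat[OF M] by simp
  next
    fix i j assume ij: "i < n" "j < n"
    have "det (mat_delete M j i) \<in> mpolys_in (hom_coords gs n)"
    proof (rule mpolys_in_det[OF mat_delete_carrier[OF M]])
      fix i' j' assume "i' < n - 1" "j' < n - 1"
      then show "mat_delete M j i $$ (i', j') \<in> mpolys_in (hom_coords gs n)"
        using M by (auto simp: mat_delete_def intro!: Mi)
    qed
    moreover have "(-1) ^ k \<in> mpolys_in I" for k :: nat and I :: "(nat \<times> nat \<times> nat) set"
      by (induction k) (auto intro: mpolys_in_one mpolys_in_uminus)
    ultimately show "adj_mat M $$ (i, j) \<in> mpolys_in (hom_coords gs n)"
      using M ij by (auto simp: adj_mat_def cofactor_def intro!: mpolys_in_mult)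
  qed (rule adj_mat(1)[OF M])
next
  case (eng g h)
  obtain M where M1: "M \<in> carrier_mat n n"
    "\<forall>i<n. \<forall>j<n. M $$ (i, j) \<in> mpolys_in (hom_coords gs n)"
    "\<forall>\<rho>\<in>hom G (SL n). \<rho> g = map_mat (\<lambda>p. mpoly_eval p (hom_point gs n \<rho>)) M"
    using eng.IH(1) by (elim bexE conjE)
  obtain M' where M2: "M' \<in> carrier_mat n n"
    "\<forall>i<n. \<forall>j<n. M' $$ (i, j) \<in> mpolys_in (hom_coords gs n)"
    "\<forall>\<rho>\<in>hom G (SL n). \<rho> h = map_mat (\<lambda>p. mpoly_eval p (hom_point gs n \<rho>)) M'"
    using eng.IH(2) by (elim bexE conjE)
  have gh: "g \<in> carrier G" "h \<in> carrier G"
    using eng.hyps generate_in_carrier[OF gs] by auto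
  show ?case
  proof (intro bexI[of _ "M * M'"] conjI allI impI ballI)
    fix \<rho> assume r: "\<rho> \<in> hom G (SL n)"
    interpret ev: comm_ring_hom "\<lambda>p. mpoly_eval p (hom_point gs n \<rho>)" by (rule comm_ring_hom_mpoly_eval)
    show "\<rho> (g \<otimes> h) = map_mat (\<lambda>p. mpoly_eval p (hom_point gs n \<rho>)) (M * M')"
      using hom_SL_mult[OF r gh] bspec[OF M1(3) r] bspec[OF M2(3) r]
        ev.mat_hom_mult[OF M1(1) M2(1)] by simp
  next
    fix i j assume ij: "i < n" "j < n"
    then show "(M * M') $$ (i, j) \<in> mpolys_in (hom_coords gs n)"
      using M1(1,2) M2(1,2) by (auto simp: scalar_prod_def intro!: mpolys_in_sum mpolys_in_mult)
  qed (use M1(1) M2(1) in auto)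
qed

lemma (in group) trace_polynomial_in_generators:
  assumes gs: "generating_tuple G gs" and g: "g \<in> carrier G"
  shows "\<exists>p\<in>mpolys_in (hom_coords gs n). \<forall>\<rho>\<in>hom G (SL n). Tr (\<rho> g) = mpoly_eval p (hom_point gs n \<rho>)"
proof -
  have "set gs \<subseteq> carrier G" "g \<in> generate G (set gs)"
    using gs g by (simp_all add: generating_tuple_def)
  from representation_polynomial_in_generators[OF this, of n]
  obtain M where M: "M \<in> carrier_mat n n"
    "\<forall>i<n. \<forall>j<n. M $$ (i, j) \<in> mpolys_in (hom_coords gs n)"
    "\<forall>\<rho>\<in>hom G (SL n). \<rho> g = map_mat (\<lambda>p. mpoly_eval p (hom_point gs n \<rho>)) M"
    by (elim bexE conjE)
  show ?thesis
  proof (intro bexI[of _ "\<Sum>i<n. M $$ (i, i)"] ballI)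
    fix \<rho> assume r: "\<rho> \<in> hom G (SL n)"
    show "Tr (\<rho> g) = mpoly_eval (\<Sum>i<n. M $$ (i, i)) (hom_point gs n \<rho>)"
      using M(1) unfolding bspec[OF M(3) r] by (auto simp: Tr_def mpoly_eval_sum intro!: sum.cong)
  qed (use M(2) in \<open>auto intro!: mpolys_in_sum\<close>)
qed

text \<open>The hypothesis on single pairs, transferred to dimension \<open>n\<close> by padding, says that each polynomial
  \<open>p x - p y\<close> is nonzero somewhere on the representation variety; irreducibility supplies a point
  where finitely many of them are nonzero together.\<close>

lemma finitely_separated_if_uniformly_D:
  assumes "group G" "uniformly_D G n" "generating_tuple G gs"
    and irr: "zariski_irreducible (hom_coords gs n) (hom_variety G gs n)"
    and F: "finite F" "F \<subseteq> nonconjugate_pairs G"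
  shows "\<exists>\<rho>\<in>hom G (SL n). \<forall>(x, y)\<in>F. Tr (\<rho> x) \<noteq> Tr (\<rho> y)"
proof -
  interpret group G by fact
  obtain p where p: "\<And>g. g \<in> carrier G \<Longrightarrow> p g \<in> mpolys_in (hom_coords gs n)"
    "\<And>g \<rho>. g \<in> carrier G \<Longrightarrow> \<rho> \<in> hom G (SL n) \<Longrightarrow> Tr (\<rho> g) = mpoly_eval (p g) (hom_point gs n \<rho>)"
    using trace_polynomial_in_generators[OF assms(3), of _ n] by metis
  have ev: "mpoly_eval (p x - p y) (hom_point gs n \<rho>) = Tr (\<rho> x) - Tr (\<rho> y)"
    if "x \<in> carrier G" "y \<in> carrier G" "\<rho> \<in> hom G (SL n)" for x y \<rho>
  proof -
    interpret ev: comm_ring_hom "\<lambda>p. mpoly_eval p (hom_point gs n \<rho>)" by (rule comm_ring_hom_mpoly_eval)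
    show ?thesis using that p(2) by (simp add: ev.hom_minus)
  qed
  let ?Q = "(\<lambda>(x, y). p x - p y) ` F"
  have "\<exists>z\<in>hom_variety G gs n. \<forall>q\<in>?Q. mpoly_eval q z \<noteq> 0"
  proof (rule zariski_irreducible_common_nonzero[OF irr])
    show "hom_variety G gs n \<subseteq> hom_coords gs n \<rightarrow>\<^sub>E UNIV"
      by (auto simp: hom_variety_def hom_point_def)
    show "finite ?Q" using F by simp
    show "?Q \<subseteq> mpolys_in (hom_coords gs n)"
      using F(2) by (auto simp: nonconjugate_pairs_def intro!: mpolys_in_diff p(1))
  next
    fix q assume "q \<in> ?Q"
    then obtain x y where xy: "x \<in> carrier G" "y \<in> carrier G" "\<not> conjugate_in G x y" "q = p x - p y"
      using F(2) by (auto simp: nonconjugate_pairs_def)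
    then obtain m \<rho> where m: "m \<le> n" "\<rho> \<in> hom G (SL m)" "Tr (\<rho> x) \<noteq> Tr (\<rho> y)"
      using assms(2) unfolding uniformly_D_def by blast
    obtain \<rho>' where "\<rho>' \<in> hom G (SL n)"
      "\<And>x. x \<in> carrier G \<Longrightarrow> Tr (\<rho>' x) = Tr (\<rho> x) + of_nat (n - m)"
      using pad_hom_SL[OF m(2,1)] by metis
    then show "\<exists>z\<in>hom_variety G gs n. mpoly_eval q z \<noteq> 0"
      using xy m(3) by (intro bexI[of _ "hom_point gs n \<rho>'"]) (auto simp: ev hom_variety_def)
  qed
  then obtain \<rho> where r: "\<rho> \<in> hom G (SL n)"
    "\<And>q. q \<in> ?Q \<Longrightarrow> mpoly_eval q (hom_point gs n \<rho>) \<noteq> 0"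
    by (auto simp: hom_variety_def)
  have "Tr (\<rho> x) \<noteq> Tr (\<rho> y)" if xy: "(x, y) \<in> F" for x y
  proof -
    have "p x - p y \<in> ?Q" using xy by force
    from r(2)[OF this] show ?thesis using ev[OF _ _ r(1)] xy F(2) by (auto simp: nonconjugate_pairs_def)
  qed
  then show ?thesis using r(1) by blast
qed

text \<open>Covers \<open>n0 = 0\<close> in the second part, where no representation of dimension \<open>n0\<close> can serve as a
  witness: uniform (D) for \<open>0\<close> holds only if all elements are conjugate.\<close>

lemma property_A_if_all_conjugate:
  assumes "nonconjugate_pairs G = {}"
  shows "property_A G"
proof -
  have "(\<lambda>_. 1\<^sub>m 1) \<in> hom G (SL 1)" by (rule hom_SL_I) auto
  moreover have "conjugate_in G x y" if "x \<in> carrier G" "y \<in> carrier G" for x y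
    using that assms by (auto simp: nonconjugate_pairs_def)
  ultimately show ?thesis unfolding property_A_def by blast
qed

theorem theorem1p1:
  fixes G :: "('a, 'b) monoid_scheme"
  assumes "group G"
    and "finitely_generated G"
    and "infinite (carrier G)"
  shows "(uniformly_C G \<longrightarrow> property_A G) \<and>
    (\<forall>n0 gs. uniformly_D G n0 \<and> generating_tuple G gs \<and>
        zariski_irreducible (hom_coords gs n0) (hom_variety G gs n0) \<longrightarrow>
      property_A G)"
proof (intro conjI allI impI)
  have count: "countable (carrier G)"
    using assms(2) countable_generate[of "set _" G] countable_finite[OF finite_set]
    unfolding finitely_generated_def generating_tuple_def by metis
  show "property_A G" if "uniformly_C G"
    using finitely_separated_if_uniformly_C[OF assms(1) that]
      property_A_if_finitely_separated[OF assms(1) count] by metis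
  fix n0 gs
  assume D: "uniformly_D G n0 \<and> generating_tuple G gs \<and>
        zariski_irreducible (hom_coords gs n0) (hom_variety G gs n0)"
  show "property_A G"
  proof (cases "nonconjugate_pairs G = {}")
    case True
    then show ?thesis by (rule property_A_if_all_conjugate)
  next
    case False
    then have "n0 \<ge> 1" using D unfolding uniformly_D_def nonconjugate_pairs_def by force
    then show ?thesis
      using D finitely_separated_if_uniformly_D[OF assms(1)]
      by (intro property_A_if_finitely_separated[OF assms(1) count]) auto
  qed
qed

end
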